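(* For $n\ge 0$ let $$Q_n(x_1,\ldots,x_7)=\sum_{\sigma\in\mathcal{S}_n(132)} x_1^{\mathrm{occr}_{12}(\sigma)}x_2^{\mathrm{occr}_{21}(\sigma)}x_3^{\mathrm{occr}_{123}(\sigma)}x_4^{\mathrm{occr}_{213}(\sigma)}x_5^{\mathrm{occr}_{231}(\sigma)}x_6^{\mathrm{occr}_{312}(\sigma)}x_7^{\mathrm{occr}_{321}(\sigma)}.$$ Then $Q_0(x_1,\ldots,x_7)=1$ and, for every $n\ge 1$, $$Q_n(x_1,\ldots,x_7)=\sum_{k=1}^{n} x_1^{k-1}x_2^{k(n-k)}x_5^{(k-1)(n-k)}\; Q_{k-1}\!\left(x_1x_3x_5^{\,n-k},\,x_2x_4x_7^{\,n-k},\,x_3,x_4,x_5,x_6,x_7\right)\; Q_{n-k}\!\left(x_1x_6^{\,k},\,x_2x_7^{\,k},\,x_3,x_4,x_5,x_6,x_7\right).$$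
   Context: $\mathcal{S}_n$ is the set of permutations of $\{1,\ldots,n\}$ in one-line notation ($\mathcal{S}_0$ consists of the empty permutation). For a sequence $w$ of distinct integers, $\mathrm{red}(w)$ is the permutation obtained by replacing the $i$-th smallest entry of $w$ by $i$. For $\tau\in\mathcal{S}_j$ and $\sigma=\sigma_1\cdots\sigma_n\in\mathcal{S}_n$, $\mathrm{occr}_\tau(\sigma)$ is the number of index sets $1\le i_1<\cdots<i_j\le n$ with $\mathrm{red}(\sigma_{i_1}\cdots\sigma_{i_j})=\tau$. The permutation $\sigma$ avoids $\tau$ if $\mathrm{occr}_\tau(\sigma)=0$, and $\mathcal{S}_n(\tau)$ is the set of $\sigma\in\mathcal{S}_n$ avoiding $\tau$. *)

theory Defs
  imports "HOL-Combinatorics.Multiset_Permutations"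
begin

text \<open>
  Permutations are in one-line notation: an element of \<open>S n\<close> is a list that enumerates
  \<open>{1..n}\<close> without repetition.
\<close>

definition S :: "nat \<Rightarrow> nat list set" where
  "S n = permutations_of_set {1..n}"

definition red :: "'a::linorder list \<Rightarrow> nat list" where
  "red w = map (\<lambda>x. card {y \<in> set w. y \<le> x}) w"

text \<open>
  List positions are counted from \<open>0\<close>, so index sets are subsets of \<open>{..<length \<sigma>}\<close>;
  \<open>nths \<sigma> I\<close> is the subsequence of \<open>\<sigma>\<close> at the positions in \<open>I\<close>, in increasing order.
\<close>

definition occr :: "nat list \<Rightarrow> nat list \<Rightarrow> nat" where
  "occr \<tau> \<sigma> = card {I. I \<subseteq> {..<length \<sigma>} \<and> card I = length \<tau> \<and> red (nths \<sigma> I) = \<tau>}"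

definition avoids :: "nat list \<Rightarrow> nat list \<Rightarrow> bool" where
  "avoids \<sigma> \<tau> \<longleftrightarrow> occr \<tau> \<sigma> = 0"

definition S_av :: "nat \<Rightarrow> nat list \<Rightarrow> nat list set" where
  "S_av n \<tau> = {\<sigma> \<in> S n. avoids \<sigma> \<tau>}"

text \<open>
  The polynomial \<open>Q\<^sub>n\<close> is given by its values at arbitrary elements of an arbitrary commutative
  semiring. Since that semiring may be a polynomial semiring and the arguments its variables, an
  identity that holds for all such arguments is an identity of polynomials.
\<close>

definition Q :: "nat \<Rightarrow> 'a \<Rightarrow> 'a \<Rightarrow> 'a \<Rightarrow> 'a \<Rightarrow> 'a \<Rightarrow> 'a \<Rightarrow> 'a \<Rightarrow> 'a::comm_semiring_1" where
  "Q n x1 x2 x3 x4 x5 x6 x7 =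
     (\<Sum>\<sigma>\<in>S_av n [1,3,2].
        x1 ^ occr [1,2] \<sigma> * x2 ^ occr [2,1] \<sigma> *
        x3 ^ occr [1,2,3] \<sigma> * x4 ^ occr [2,1,3] \<sigma> * x5 ^ occr [2,3,1] \<sigma> *
        x6 ^ occr [3,1,2] \<sigma> * x7 ^ occr [3,2,1] \<sigma>)"

end

theory Submission imports Defs begin

text \<open>
  A permutation \<open>\<sigma>\<close> of \<open>{1..n}\<close> that avoids 132 and has its maximum at the \<open>k\<close>-th position is
  \<open>L n R\<close> where every entry of \<open>L\<close> exceeds every entry of \<open>R\<close>. Hence \<open>L\<close> is a shifted copy of an
  element of \<open>S_av (k - 1) [1,3,2]\<close>, \<open>R\<close> is an element of \<open>S_av (n - k) [1,3,2]\<close>, and both can be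
  chosen freely. An occurrence of a pattern in \<open>\<sigma>\<close> is split by its intersections with \<open>L\<close>, \<open>n\<close>
  and \<open>R\<close>, which contribute independently because the relative order of the three parts is known.
\<close>

section \<open>Sums over subsequences of length one, two and three\<close>

definition subseq_sum1 :: "('a \<Rightarrow> nat) \<Rightarrow> 'a list \<Rightarrow> nat" where
  "subseq_sum1 f xs = sum_list (map f xs)"

text \<open>The recursion is on the first chosen entry. Arguments thus keep their list order, and
  what remains is a sum over subsequences that are shorter by one.\<close>

fun subseq_sum2 :: "('a \<Rightarrow> 'a \<Rightarrow> nat) \<Rightarrow> 'a list \<Rightarrow> nat" where
  "subseq_sum2 f [] = 0"
| "subseq_sum2 f (x # xs) = subseq_sum1 (f x) xs + subseq_sum2 f xs"

fun subseq_sum3 :: "('a \<Rightarrow> 'a \<Rightarrow> 'a \<Rightarrow> nat) \<Rightarrow> 'a list \<Rightarrow> nat" where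
  "subseq_sum3 f [] = 0"
| "subseq_sum3 f (x # xs) = subseq_sum2 (f x) xs + subseq_sum3 f xs"

lemma subseq_sum1_simps [simp]:
  "subseq_sum1 f [] = 0"
  "subseq_sum1 f (x # xs) = f x + subseq_sum1 f xs"
  by (simp_all add: subseq_sum1_def)

lemma subseq_sum1_append [simp]:
  "subseq_sum1 f (xs @ ys) = subseq_sum1 f xs + subseq_sum1 f ys"
  by (simp add: subseq_sum1_def)

lemma subseq_sum1_add:
  "subseq_sum1 (\<lambda>a. f a + g a) xs = subseq_sum1 f xs + subseq_sum1 g xs"
  by (induction xs) auto

lemma subseq_sum2_add:
  "subseq_sum2 (\<lambda>a b. f a b + g a b) xs = subseq_sum2 f xs + subseq_sum2 g xs"
  by (induction xs) (auto simp: subseq_sum1_add)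

lemma subseq_sum2_append:
  "subseq_sum2 f (xs @ ys) =
     subseq_sum2 f xs + subseq_sum1 (\<lambda>a. subseq_sum1 (f a) ys) xs + subseq_sum2 f ys"
  by (induction xs) auto

text \<open>The four terms come from triples with three, two, one or no entries in
  \<open>xs\<close>.\<close>

lemma subseq_sum3_append:
  "subseq_sum3 f (xs @ ys) =
     subseq_sum3 f xs + subseq_sum2 (\<lambda>a b. subseq_sum1 (f a b) ys) xs +
     subseq_sum1 (\<lambda>a. subseq_sum2 (f a) ys) xs + subseq_sum3 f ys"
  by (induction xs) (auto simp: subseq_sum2_append)

lemma subseq_sum1_cong:
  assumes "\<And>a. a \<in> set xs \<Longrightarrow> f a = g a"
  shows "subseq_sum1 f xs = subseq_sum1 g xs"
  using assms by (induction xs) auto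

lemma subseq_sum2_cong:
  assumes "\<And>a b. a \<in> set xs \<Longrightarrow> b \<in> set xs \<Longrightarrow> f a b = g a b"
  shows "subseq_sum2 f xs = subseq_sum2 g xs"
  using assms
proof (induction xs)
  case (Cons x xs)
  then have "subseq_sum1 (f x) xs = subseq_sum1 (g x) xs"
    by (intro subseq_sum1_cong) auto
  with Cons show ?case by simp
qed simp

lemma subseq_sum1_const [simp]: "subseq_sum1 (\<lambda>_. c) xs = c * length xs"
  by (induction xs) auto

lemma subseq_sum2_zero [simp]: "subseq_sum2 (\<lambda>_ _. 0) xs = 0"
  by (induction xs) auto

lemma subseq_sum1_mult: "subseq_sum1 (\<lambda>a. f a * c) xs = subseq_sum1 f xs * c"
  by (induction xs) (auto simp: algebra_simps)

lemma subseq_sum2_mult: "subseq_sum2 (\<lambda>a b. f a b * c) xs = subseq_sum2 f xs * c"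
  by (induction xs) (auto simp: distrib_right subseq_sum1_mult)

lemma subseq_sum1_map: "subseq_sum1 f (map h xs) = subseq_sum1 (\<lambda>a. f (h a)) xs"
  by (induction xs) auto

lemma subseq_sum2_map: "subseq_sum2 f (map h xs) = subseq_sum2 (\<lambda>a b. f (h a) (h b)) xs"
  by (induction xs) (auto simp: subseq_sum1_map)

lemma subseq_sum3_map:
  "subseq_sum3 f (map h xs) = subseq_sum3 (\<lambda>a b c. f (h a) (h b) (h c)) xs"
  by (induction xs) (auto simp: subseq_sum2_map)

lemma subseq_sum1_eq_0_iff: "subseq_sum1 f xs = 0 \<longleftrightarrow> (\<forall>a\<in>set xs. f a = 0)"
  by (induction xs) auto

section \<open>Counting index sets by induction on the list\<close>

definition subseq_count :: "('a list \<Rightarrow> bool) \<Rightarrow> 'a list \<Rightarrow> nat" where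
  "subseq_count P xs = card {I. I \<subseteq> {..<length xs} \<and> P (nths xs I)}"

lemma subseq_count_Nil [simp]: "subseq_count P [] = of_bool (P [])"
proof -
  have "{I :: nat set. I \<subseteq> {} \<and> P []} = (if P [] then {{}} else {})"
    by auto
  then show ?thesis
    by (simp add: subseq_count_def)
qed

text \<open>Index sets are split by whether they contain position 0; the other positions are shifted
  down by one. Allowing an arbitrary predicate, with no fixed size of the index set, is what lets
  the first chosen entry be absorbed into it.\<close>

lemma subseq_count_Cons [simp]:
  "subseq_count P (x # xs) = subseq_count (\<lambda>w. P (x # w)) xs + subseq_count P xs"
proof -
  define A where "A p = {I. I \<subseteq> {..<length xs} \<and> p (nths xs I)}" for p
  have fin: "finite (A p)" for p
    by (rule finite_subset[of _ "Pow {..<length xs}"]) (auto simp: A_def)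
  have pre: "{j. Suc j \<in> Suc ` I} = I" "{j. Suc j \<in> insert 0 (Suc ` I)} = I" for I
    by auto
  have dec: "I = Suc ` {j. Suc j \<in> I}" if "0 \<notin> I" for I
  proof -
    have "i \<in> Suc ` {j. Suc j \<in> I}" if "i \<in> I" for i
      using that \<open>0 \<notin> I\<close> by (cases i) auto
    then show ?thesis by auto
  qed
  have dec': "I = insert 0 (Suc ` {j. Suc j \<in> I})" if "0 \<in> I" for I
  proof -
    have "i \<in> insert 0 (Suc ` {j. Suc j \<in> I})" if "i \<in> I" for i
      using that by (cases i) auto
    then show ?thesis using that by auto
  qed
  have "{I. I \<subseteq> {..<length (x # xs)} \<and> P (nths (x # xs) I)} =
        (\<lambda>I. insert 0 (Suc ` I)) ` A (\<lambda>w. P (x # w)) \<union> (`) Suc ` A P" (is "?X = ?Y \<union> ?Z")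
  proof (intro equalityI subsetI)
    fix I assume I: "I \<in> ?X"
    then have sub: "{j. Suc j \<in> I} \<subseteq> {..<length xs}" by auto
    show "I \<in> ?Y \<union> ?Z"
    proof (cases "0 \<in> I")
      case True
      then have "{j. Suc j \<in> I} \<in> A (\<lambda>w. P (x # w))"
        using I sub by (auto simp: A_def nths_Cons)
      then show ?thesis using dec'[OF True] by blast
    next
      case False
      then have "{j. Suc j \<in> I} \<in> A P"
        using I sub by (auto simp: A_def nths_Cons)
      then show ?thesis using dec[OF False] by blast
    qed
  next
    fix I assume "I \<in> ?Y \<union> ?Z"
    then show "I \<in> ?X"
      by (auto simp: A_def nths_Cons pre inj_image_mem_iff)
  qed
  moreover have "?Y \<inter> ?Z = {}" by auto
  moreover have "inj_on (\<lambda>I. insert 0 (Suc ` I)) B" for B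
    by (rule inj_onI) (metis pre(2))
  moreover have "inj_on ((`) Suc) B" for B :: "nat set set"
    by (rule inj_onI) (metis pre(1))
  moreover have "subseq_count p xs = card (A p)" for p
    by (simp add: subseq_count_def A_def)
  ultimately show ?thesis
    using fin by (simp add: subseq_count_def[of _ "x # xs"] card_Un_disjoint card_image)
qed

lemma subseq_count_False [simp]: "subseq_count (\<lambda>_. False) xs = 0"
  by (simp add: subseq_count_def)

text \<open>This is the predicate left over when a pattern of length one has used up its only entry;
  it starts the chain of counts for lengths one, two and three.\<close>

lemma subseq_count_0 [simp]: "subseq_count (\<lambda>w. w = [] \<and> p) xs = of_bool p"
  by (induction xs) auto

lemma subseq_count_1:
  "subseq_count (\<lambda>w. \<exists>a. w = [a] \<and> p a) xs = subseq_sum1 (\<lambda>a. of_bool (p a)) xs"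
  by (induction xs) auto

lemma subseq_count_2:
  "subseq_count (\<lambda>w. \<exists>a b. w = [a, b] \<and> p a b) xs = subseq_sum2 (\<lambda>a b. of_bool (p a b)) xs"
  by (induction xs) (auto simp: subseq_count_1)

lemma subseq_count_3:
  "subseq_count (\<lambda>w. \<exists>a b c. w = [a, b, c] \<and> p a b c) xs =
     subseq_sum3 (\<lambda>a b c. of_bool (p a b c)) xs"
  by (induction xs) (auto simp: subseq_count_2)

section \<open>Pattern occurrences as sums of indicators\<close>

lemma length_red [simp]: "length (red w) = length w"
  by (simp add: red_def)

text \<open>The size condition in \<open>occr\<close> follows from the other two: \<open>red\<close>
  preserves length, and \<open>nths\<close> selects one entry per index.\<close>

lemma occr_eq_subseq_count: "occr \<tau> \<sigma> = subseq_count (\<lambda>w. red w = \<tau>) \<sigma>"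
proof -
  have "card I = length \<tau>" if "I \<subseteq> {..<length \<sigma>}" "red (nths \<sigma> I) = \<tau>" for I
  proof -
    have "{i. i < length \<sigma> \<and> i \<in> I} = I" using that(1) by auto
    then have "length (nths \<sigma> I) = card I" by (simp add: length_nths)
    with that(2) show ?thesis by (metis length_red)
  qed
  then have "{I. I \<subseteq> {..<length \<sigma>} \<and> card I = length \<tau> \<and> red (nths \<sigma> I) = \<tau>} =
      {I. I \<subseteq> {..<length \<sigma>} \<and> red (nths \<sigma> I) = \<tau>}"
    by blast
  then show ?thesis
    by (simp only: occr_def subseq_count_def)
qed

lemma occr_2:
  assumes "length \<tau> = 2"
  shows "occr \<tau> \<sigma> = subseq_sum2 (\<lambda>a b. of_bool (red [a, b] = \<tau>)) \<sigma>"
proof -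
  have iff: "red w = \<tau> \<longleftrightarrow> (\<exists>a b. w = [a, b] \<and> red [a, b] = \<tau>)" for w :: "nat list"
  proof
    assume red: "red w = \<tau>"
    then have "length w = 2" using assms by (metis length_red)
    then obtain a b where "w = [a, b]"
      by (auto simp: numeral_2_eq_2 length_Suc_conv)
    with red show "\<exists>a b. w = [a, b] \<and> red [a, b] = \<tau>" by blast
  qed auto
  have "(\<lambda>w :: nat list. red w = \<tau>) = (\<lambda>w. \<exists>a b. w = [a, b] \<and> red [a, b] = \<tau>)"
    by (rule ext[OF iff])
  then show ?thesis
    by (simp only: occr_eq_subseq_count subseq_count_2)
qed

lemma occr_3:
  assumes "length \<tau> = 3"
  shows "occr \<tau> \<sigma> = subseq_sum3 (\<lambda>a b c. of_bool (red [a, b, c] = \<tau>)) \<sigma>"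
proof -
  have iff: "red w = \<tau> \<longleftrightarrow> (\<exists>a b c. w = [a, b, c] \<and> red [a, b, c] = \<tau>)" for w :: "nat list"
  proof
    assume red: "red w = \<tau>"
    then have "length w = 3" using assms by (metis length_red)
    then obtain a b c where "w = [a, b, c]"
      by (auto simp: numeral_3_eq_3 length_Suc_conv)
    with red show "\<exists>a b c. w = [a, b, c] \<and> red [a, b, c] = \<tau>" by blast
  qed auto
  have "(\<lambda>w :: nat list. red w = \<tau>) = (\<lambda>w. \<exists>a b c. w = [a, b, c] \<and> red [a, b, c] = \<tau>)"
    by (rule ext[OF iff])
  then show ?thesis
    by (simp only: occr_eq_subseq_count subseq_count_3)
qed

lemma Collect_insert_le:
  "{y. (y = a \<or> P y) \<and> y \<le> x} = (if a \<le> x then insert a {y. P y \<and> y \<le> x} else {y. P y \<and> y \<le> x})"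
  by auto

lemma Collect_eq_le: "{y. y = a \<and> y \<le> x} = (if a \<le> x then {a} else {})"
  by auto

lemma red_2_iff:
  fixes a b :: nat
  shows "red [a, b] = [1, 2] \<longleftrightarrow> a < b" "red [a, b] = [2, 1] \<longleftrightarrow> b < a"
  by (auto simp: red_def Collect_insert_le Collect_eq_le card_insert_if)

text \<open>All relative orders of the entries are evaluated, ties included. A tie makes
  \<open>red\<close> repeat a value, so no pattern matches, and the strict inequalities fail
  too.\<close>

lemma red_3_iff:
  fixes a b c :: nat
  shows "red [a, b, c] = [1, 2, 3] \<longleftrightarrow> a < b \<and> b < c"
    and "red [a, b, c] = [1, 3, 2] \<longleftrightarrow> a < c \<and> c < b"
    and "red [a, b, c] = [2, 1, 3] \<longleftrightarrow> b < a \<and> a < c"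
    and "red [a, b, c] = [2, 3, 1] \<longleftrightarrow> c < a \<and> a < b"
    and "red [a, b, c] = [3, 1, 2] \<longleftrightarrow> b < c \<and> c < a"
    and "red [a, b, c] = [3, 2, 1] \<longleftrightarrow> c < b \<and> b < a"
  by (cases a b rule: linorder_cases; cases b c rule: linorder_cases;
      cases a c rule: linorder_cases; simp add: red_def Collect_insert_le Collect_eq_le)+

lemma occr_eqs:
  "occr [1,2] \<sigma> = subseq_sum2 (\<lambda>a b. of_bool (a < b)) \<sigma>"
  "occr [2,1] \<sigma> = subseq_sum2 (\<lambda>a b. of_bool (b < a)) \<sigma>"
  "occr [1,2,3] \<sigma> = subseq_sum3 (\<lambda>a b c. of_bool (a < b \<and> b < c)) \<sigma>"
  "occr [1,3,2] \<sigma> = subseq_sum3 (\<lambda>a b c. of_bool (a < c \<and> c < b)) \<sigma>"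
  "occr [2,1,3] \<sigma> = subseq_sum3 (\<lambda>a b c. of_bool (b < a \<and> a < c)) \<sigma>"
  "occr [2,3,1] \<sigma> = subseq_sum3 (\<lambda>a b c. of_bool (c < a \<and> a < b)) \<sigma>"
  "occr [3,1,2] \<sigma> = subseq_sum3 (\<lambda>a b c. of_bool (b < c \<and> c < a)) \<sigma>"
  "occr [3,2,1] \<sigma> = subseq_sum3 (\<lambda>a b c. of_bool (c < b \<and> b < a)) \<sigma>"
  by (simp_all add: occr_2 occr_3 red_2_iff[unfolded One_nat_def] red_3_iff[unfolded One_nat_def])

section \<open>Pattern counts of two permutations glued around a new maximum\<close>

definition join :: "nat list \<Rightarrow> nat list \<Rightarrow> nat list" where
  "join L R = map ((+) (length R)) L @ Suc (length L + length R) # R"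

text \<open>Meant for indicators of a relative order: for entries from different parts the value
  depends only on the parts, hence the constants \<open>p\<close>, \<open>q\<close>,
  \<open>r\<close>.\<close>

lemma subseq_sum2_append_Cons:
  fixes f :: "nat \<Rightarrow> nat \<Rightarrow> nat"
  assumes "\<And>a c. a \<in> set L \<Longrightarrow> c \<in> set R \<Longrightarrow> f a c = p"
    and "\<And>a. a \<in> set L \<Longrightarrow> f a M = q"
    and "\<And>c. c \<in> set R \<Longrightarrow> f M c = r"
  shows "subseq_sum2 f (L @ M # R) =
    subseq_sum2 f L + subseq_sum2 f R + p * length L * length R + q * length L + r * length R"
proof -
  have "subseq_sum1 (f a) R = p * length R" if "a \<in> set L" for a
    using subseq_sum1_cong[of R "f a" "\<lambda>_. p"] assms(1) that by simp
  then have "subseq_sum1 (\<lambda>a. subseq_sum1 (f a) (M # R)) L =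
      subseq_sum1 (\<lambda>_. q + p * length R) L"
    using assms(2) by (intro subseq_sum1_cong) simp
  moreover have "subseq_sum1 (f M) R = r * length R"
    using subseq_sum1_cong[of R "f M" "\<lambda>_. r"] assms(3) by simp
  ultimately show ?thesis
    by (simp add: subseq_sum2_append algebra_simps)
qed

text \<open>The parameters are the five ways a triple can straddle the parts: LLR, LLM, LMR, LRR and
  MRR. Only two entries from the same part still need to be compared, so \<open>p\<close>,
  \<open>q\<close>, \<open>s\<close>, \<open>t\<close> are functions of that pair and
  \<open>r\<close> is a constant.\<close>

lemma subseq_sum3_append_Cons:
  fixes f :: "nat \<Rightarrow> nat \<Rightarrow> nat \<Rightarrow> nat"
  assumes "\<And>a b c. a \<in> set L \<Longrightarrow> b \<in> set L \<Longrightarrow> c \<in> set R \<Longrightarrow> f a b c = p a b"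
    and "\<And>a b. a \<in> set L \<Longrightarrow> b \<in> set L \<Longrightarrow> f a b M = q a b"
    and "\<And>a c. a \<in> set L \<Longrightarrow> c \<in> set R \<Longrightarrow> f a M c = r"
    and "\<And>a b c. a \<in> set L \<Longrightarrow> b \<in> set R \<Longrightarrow> c \<in> set R \<Longrightarrow> f a b c = s b c"
    and "\<And>b c. b \<in> set R \<Longrightarrow> c \<in> set R \<Longrightarrow> f M b c = t b c"
  shows "subseq_sum3 f (L @ M # R) =
    subseq_sum3 f L + subseq_sum3 f R + subseq_sum2 p L * length R + subseq_sum2 q L +
    r * length L * length R + subseq_sum2 s R * length L + subseq_sum2 t R"
proof -
  have "subseq_sum1 (f a b) R = p a b * length R" if "a \<in> set L" "b \<in> set L" for a b
    using subseq_sum1_cong[of R "f a b" "\<lambda>_. p a b"] assms(1) that by simp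
  then have "subseq_sum2 (\<lambda>a b. subseq_sum1 (f a b) (M # R)) L =
      subseq_sum2 (\<lambda>a b. q a b + p a b * length R) L"
    using assms(2) by (intro subseq_sum2_cong) simp
  then have "subseq_sum2 (\<lambda>a b. subseq_sum1 (f a b) (M # R)) L =
      subseq_sum2 q L + subseq_sum2 p L * length R"
    by (simp only: subseq_sum2_add subseq_sum2_mult)
  moreover have "subseq_sum1 (\<lambda>a. subseq_sum2 (f a) (M # R)) L =
      subseq_sum1 (\<lambda>_. r * length R + subseq_sum2 s R) L"
  proof (rule subseq_sum1_cong)
    fix a assume a: "a \<in> set L"
    have "subseq_sum1 (f a M) R = r * length R"
      using subseq_sum1_cong[of R "f a M" "\<lambda>_. r"] assms(3) a by simp
    moreover have "subseq_sum2 (f a) R = subseq_sum2 s R"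
      using assms(4) a by (intro subseq_sum2_cong) simp
    ultimately show "subseq_sum2 (f a) (M # R) = r * length R + subseq_sum2 s R" by simp
  qed
  moreover have "subseq_sum2 (f M) R = subseq_sum2 t R"
    using assms(5) by (intro subseq_sum2_cong) simp
  ultimately show ?thesis
    by (simp add: subseq_sum3_append algebra_simps)
qed

text \<open>The shifted \<open>L\<close> lies above \<open>R\<close>, and the new entry above both.
  For example, a straddling 231 is an ascent in \<open>L\<close> followed by an entry of
  \<open>R\<close>, or has the form LMR. A straddling 312 is an ascent in \<open>R\<close> preceded
  by an entry of \<open>L\<close> or by the maximum, which explains the factor
  \<open>Suc (length L)\<close>.\<close>

lemma occr_join:
  assumes "set L = {1..length L}" "set R = {1..length R}"
  shows
    "occr [1,2] (join L R) = occr [1,2] L + occr [1,2] R + length L"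
    "occr [2,1] (join L R) = occr [2,1] L + occr [2,1] R + Suc (length L) * length R"
    "occr [1,2,3] (join L R) = occr [1,2,3] L + occr [1,2,3] R + occr [1,2] L"
    "occr [1,3,2] (join L R) = occr [1,3,2] L + occr [1,3,2] R"
    "occr [2,1,3] (join L R) = occr [2,1,3] L + occr [2,1,3] R + occr [2,1] L"
    "occr [2,3,1] (join L R) = occr [2,3,1] L + occr [2,3,1] R + occr [1,2] L * length R +
       length L * length R"
    "occr [3,1,2] (join L R) = occr [3,1,2] L + occr [3,1,2] R + Suc (length L) * occr [1,2] R"
    "occr [3,2,1] (join L R) = occr [3,2,1] L + occr [3,2,1] R + occr [2,1] L * length R +
       Suc (length L) * occr [2,1] R"
proof -
  let ?L = "map ((+) (length R)) L" and ?M = "Suc (length L + length R)"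
  have LR: "c < a" if "a \<in> set ?L" "c \<in> set R" for a c
    using that assms by auto
  have LM: "a < ?M" if "a \<in> set ?L" for a
    using that assms by auto
  have RM: "c < ?M" if "c \<in> set R" for c
    using that assms by auto
  \<comment> \<open>With the inequalities and their negated converses, every comparison across two
    parts is decided.\<close>
  note order = LR LM RM less_imp_not_less[OF LR] less_imp_not_less[OF LM] less_imp_not_less[OF RM]
  \<comment> \<open>Adding \<open>length R\<close> to all entries changes no comparison within
    \<open>L\<close>.\<close>
  note shift = subseq_sum2_map subseq_sum3_map
  show "occr [1,2] (join L R) = occr [1,2] L + occr [1,2] R + length L"
    unfolding occr_eqs join_def
    by (subst subseq_sum2_append_Cons[where p = 0 and q = 1 and r = 0])
      (use order in \<open>auto simp: shift simp del: set_map\<close>)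
  show "occr [2,1] (join L R) = occr [2,1] L + occr [2,1] R + Suc (length L) * length R"
    unfolding occr_eqs join_def
    by (subst subseq_sum2_append_Cons[where p = 1 and q = 0 and r = 1])
      (use order in \<open>auto simp: shift simp del: set_map\<close>)
  show "occr [1,2,3] (join L R) = occr [1,2,3] L + occr [1,2,3] R + occr [1,2] L"
    unfolding occr_eqs join_def
    by (subst subseq_sum3_append_Cons[where p = "\<lambda>_ _. 0" and q = "\<lambda>a b. of_bool (a < b)" and r = 0
          and s = "\<lambda>_ _. 0" and t = "\<lambda>_ _. 0"])
      (use order in \<open>auto simp: shift simp del: set_map\<close>)
  \<comment> \<open>The maximum could only play the 3, so a straddling 132 would start in the
    shifted \<open>L\<close> and end in \<open>R\<close>; but its last entry must exceed its
    first.\<close>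
  show "occr [1,3,2] (join L R) = occr [1,3,2] L + occr [1,3,2] R"
    unfolding occr_eqs join_def
    by (subst subseq_sum3_append_Cons[where p = "\<lambda>_ _. 0" and q = "\<lambda>_ _. 0" and r = 0
          and s = "\<lambda>_ _. 0" and t = "\<lambda>_ _. 0"])
      (use order in \<open>auto simp: shift simp del: set_map\<close>)
  show "occr [2,1,3] (join L R) = occr [2,1,3] L + occr [2,1,3] R + occr [2,1] L"
    unfolding occr_eqs join_def
    by (subst subseq_sum3_append_Cons[where p = "\<lambda>_ _. 0" and q = "\<lambda>a b. of_bool (b < a)" and r = 0
          and s = "\<lambda>_ _. 0" and t = "\<lambda>_ _. 0"])
      (use order in \<open>auto simp: shift simp del: set_map\<close>)
  show "occr [2,3,1] (join L R) = occr [2,3,1] L + occr [2,3,1] R + occr [1,2] L * length R +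
      length L * length R"
    unfolding occr_eqs join_def
    by (subst subseq_sum3_append_Cons[where p = "\<lambda>a b. of_bool (a < b)" and q = "\<lambda>_ _. 0" and r = 1
          and s = "\<lambda>_ _. 0" and t = "\<lambda>_ _. 0"])
      (use order in \<open>auto simp: shift simp del: set_map\<close>)
  show "occr [3,1,2] (join L R) = occr [3,1,2] L + occr [3,1,2] R + Suc (length L) * occr [1,2] R"
    unfolding occr_eqs join_def
    by (subst subseq_sum3_append_Cons[where p = "\<lambda>_ _. 0" and q = "\<lambda>_ _. 0" and r = 0
          and s = "\<lambda>b c. of_bool (b < c)" and t = "\<lambda>b c. of_bool (b < c)"])
      (use order in \<open>auto simp: shift simp del: set_map\<close>)
  show "occr [3,2,1] (join L R) = occr [3,2,1] L + occr [3,2,1] R + occr [2,1] L * length R +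
      Suc (length L) * occr [2,1] R"
    unfolding occr_eqs join_def
    by (subst subseq_sum3_append_Cons[where p = "\<lambda>a b. of_bool (b < a)" and q = "\<lambda>_ _. 0" and r = 0
          and s = "\<lambda>b c. of_bool (c < b)" and t = "\<lambda>b c. of_bool (c < b)"])
      (use order in \<open>auto simp: shift simp del: set_map\<close>)
qed

section \<open>Decomposing 132-avoiding permutations at the maximum\<close>

lemma S_iff: "\<sigma> \<in> S n \<longleftrightarrow> set \<sigma> = {1..n} \<and> distinct \<sigma>"
  by (simp add: S_def permutations_of_set_def)

lemma S_length: "\<sigma> \<in> S n \<Longrightarrow> length \<sigma> = n"
  unfolding S_iff by (metis card_atLeastAtMost diff_Suc_1 distinct_card)

lemma S_set_length:
  assumes "\<sigma> \<in> S n"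
  shows "set \<sigma> = {1..length \<sigma>}"
  using assms S_length[OF assms] by (simp add: S_iff)

lemma join_in_S:
  assumes "L \<in> S j" "R \<in> S i"
  shows "join L R \<in> S (Suc (j + i))"
proof -
  have "(+) i ` {1..j} = {Suc i..i + j}" by auto
  then have "set (join L R) = {1..Suc (j + i)}"
    using assms S_length[OF assms(1)] S_length[OF assms(2)] unfolding join_def S_iff by auto
  moreover have "distinct (join L R)"
    using assms S_length[OF assms(1)] S_length[OF assms(2)] unfolding join_def S_iff
    by (auto simp: distinct_map)
  ultimately show ?thesis by (simp add: S_iff)
qed

lemma join_in_S_av_iff:
  assumes "L \<in> S j" "R \<in> S i"
  shows "join L R \<in> S_av (Suc (j + i)) [1,3,2] \<longleftrightarrow> L \<in> S_av j [1,3,2] \<and> R \<in> S_av i [1,3,2]"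
  using assms join_in_S[OF assms] occr_join(4)[OF S_set_length S_set_length, OF assms]
  unfolding S_av_def avoids_def by simp

text \<open>Every element of \<open>A\<close> exceeds \<open>Max B\<close>, so all of 1, ...,
  \<open>Max B\<close> must belong to \<open>B\<close>. This recovers the value sets of the two
  sides of the maximum.\<close>

lemma lower_part_interval:
  fixes A B :: "nat set"
  assumes "A \<union> B = {1..m}" and less: "\<And>a b. a \<in> A \<Longrightarrow> b \<in> B \<Longrightarrow> b < a"
  shows "B = {1..card B}" "A = {Suc (card B)..m}"
proof -
  have fin: "finite B" using assms(1) by (metis finite_Un finite_atLeastAtMost)
  have "\<exists>k\<le>m. B = {1..k}"
  proof (cases "B = {}")
    case False
    have "B = {1..Max B}"
    proof (intro equalityI subsetI)
      fix x assume "x \<in> {1..Max B}"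
      moreover have "Max B \<in> B" using fin False by simp
      moreover from this have "Max B \<le> m" using assms(1) by auto
      ultimately have "x \<in> A \<union> B" "x \<in> A \<longrightarrow> Max B < x" "x \<le> Max B"
        unfolding assms(1) by (auto simp: less)
      then show "x \<in> B" by auto
    qed (use assms(1) fin in auto)
    moreover have "Max B \<in> {1..m}"
      using Max_in[OF fin False] assms(1) by auto
    ultimately show ?thesis by auto
  qed auto
  then obtain k where k: "k \<le> m" "B = {1..k}" by blast
  then show "B = {1..card B}" by simp
  \<comment> \<open>A common element would be smaller than itself.\<close>
  have "a \<notin> B" if "a \<in> A" for a using less[OF that, of a] by auto
  then have "A = {1..m} - B" using assms(1) by auto
  then show "A = {Suc (card B)..m}" using k by auto
qed

text \<open>If some entry a before the maximum were below some entry b after it, then a,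
  \<open>Suc m\<close>, b would form a 132. So the entries after the maximum are the smallest
  ones.\<close>

lemma S_av_decompose:
  assumes "\<sigma> \<in> S_av (Suc m) [1,3,2]"
  obtains j L R where "j \<le> m" "L \<in> S_av j [1,3,2]" "R \<in> S_av (m - j) [1,3,2]" "\<sigma> = join L R"
proof -
  have \<sigma>: "set \<sigma> = {1..Suc m}" "distinct \<sigma>" "occr [1,3,2] \<sigma> = 0"
    using assms by (auto simp: S_av_def avoids_def S_iff)
  then have "Suc m \<in> set \<sigma>" by simp
  then obtain A R where split: "\<sigma> = A @ Suc m # R"
    by (meson split_list)
  have union: "set A \<union> set R = {1..m}"
  proof -
    have "set A \<union> set R = set \<sigma> - {Suc m}" using \<sigma>(2) split by auto
    also have "\<dots> = {1..m}" unfolding \<sigma>(1) by auto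
    finally show ?thesis .
  qed
  have "b < a" if "a \<in> set A" "b \<in> set R" for a b
  proof -
    \<comment> \<open>This is the part of the 132 count with the maximum in the middle; as a summand
      of a vanishing sum of naturals it is 0.\<close>
    have "subseq_sum1 (\<lambda>a. subseq_sum1 (\<lambda>c. of_bool (a < c \<and> c < Suc m)) R) A = 0"
      using \<sigma>(3) unfolding occr_eqs split
      by (simp add: subseq_sum3_append subseq_sum1_add)
    then have "\<not> (a < b \<and> b < Suc m)"
      using that by (auto simp: subseq_sum1_eq_0_iff)
    moreover have "b \<le> m" using union that by auto
    moreover have "a \<noteq> b" using \<sigma>(2) split that by auto
    ultimately show ?thesis by simp
  qed
  from lower_part_interval[OF union this]
  have sets: "set R = {1..length R}" "set A = {Suc (length R)..m}"
    using \<sigma>(2) split by (auto simp: distinct_card)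
  have len: "length A + length R = m"
    using arg_cong[OF \<sigma>(1), of card] distinct_card[OF \<sigma>(2)] split by simp
  define L where "L = map (\<lambda>x. x - length R) A"
  \<comment> \<open>The truncated subtraction loses nothing, since all entries of \<open>A\<close>
    exceed \<open>length R\<close>.\<close>
  have A: "A = map ((+) (length R)) L"
    unfolding L_def using sets by (auto simp: o_def intro!: map_idI[symmetric])
  have "length L = length A" by (simp add: L_def)
  then have join: "\<sigma> = join L R"
    using split A len by (simp add: join_def)
  have "set L = {1..length A}"
  proof -
    have "(+) (length R) ` set L = {Suc (length R)..m}" using sets(2) A by simp
    also have "\<dots> = (+) (length R) ` {1..length A}" using len by (simp flip: len)
    finally show ?thesis by (rule inj_image_eq_iff[OF inj_on_add, THEN iffD1])
  qed
  moreover have "distinct L" using \<sigma>(2) split A by (simp add: distinct_map)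
  ultimately have "L \<in> S (length A)" by (simp add: S_iff)
  moreover have "R \<in> S (length R)" using sets \<sigma>(2) split by (simp add: S_iff)
  ultimately show ?thesis
    using that[of "length A" L R] join_in_S_av_iff[of L "length A" R "length R"] assms join len
    by auto
qed

text \<open>Here j is the length of \<open>L\<close>, one less than the position of the maximum. It
  indexes a dependent sum because it fixes the sizes of both factors.\<close>

lemma bij_betw_join:
  "bij_betw (\<lambda>(j, L, R). join L R)
     (SIGMA j:{..m}. S_av j [1,3,2] \<times> S_av (m - j) [1,3,2]) (S_av (Suc m) [1,3,2])"
    (is "bij_betw ?f ?X ?Y")
  unfolding bij_betw_def
proof
  show "inj_on ?f ?X"
  proof (rule inj_onI)
    fix p p' assume p: "p \<in> ?X" "p' \<in> ?X" "?f p = ?f p'"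
    obtain j L R j' L' R' where pp: "p = (j, L, R)" "p' = (j', L', R')"
      by (metis prod_cases3)
    from p have j: "j \<in> {..m}" "j' \<in> {..m}"
      and av: "L \<in> S_av j [1,3,2]" "R \<in> S_av (m - j) [1,3,2]"
        "L' \<in> S_av j' [1,3,2]" "R' \<in> S_av (m - j') [1,3,2]"
      and eq: "join L R = join L' R'"
      by (auto simp: pp)
    have S: "L \<in> S j" "R \<in> S (m - j)" "L' \<in> S j'" "R' \<in> S (m - j')"
      using av by (auto simp: S_av_def)
    note len = S[THEN S_length] and sets = S[unfolded S_iff]
    \<comment> \<open>The entry \<open>Suc m\<close> exceeds all others, so both lists split at it
      in the same place. Equal right parts then give equal shifts, and the left parts agree by
      injectivity.\<close>
    have "map ((+) (length R)) L = map ((+) (length R')) L' \<and> R = R'"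
    proof (rule append_Cons_eq_iff[THEN iffD1])
      show "map ((+) (length R)) L @ Suc m # R = map ((+) (length R')) L' @ Suc m # R'"
        using eq j by (simp add: join_def len)
    qed (use sets j len in auto)
    then have "R = R'" "map ((+) (length R)) L = map ((+) (length R)) L'" by auto
    moreover from this have "L = L'" by (simp add: inj_map_eq_map)
    ultimately show "p = p'" using len by (auto simp: pp)
  qed
  show "?f ` ?X = ?Y"
  proof (intro equalityI subsetI)
    fix \<sigma> assume "\<sigma> \<in> ?f ` ?X"
    then obtain j L R where "j \<le> m" "L \<in> S_av j [1,3,2]" "R \<in> S_av (m - j) [1,3,2]"
      "\<sigma> = join L R" by auto
    then show "\<sigma> \<in> ?Y"
      using join_in_S_av_iff[of L j R "m - j"] by (simp add: S_av_def)
  next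
    fix \<sigma> assume "\<sigma> \<in> ?Y"
    then obtain j L R where "j \<le> m" "L \<in> S_av j [1,3,2]" "R \<in> S_av (m - j) [1,3,2]"
      "\<sigma> = join L R" by (rule S_av_decompose)
    then show "\<sigma> \<in> ?f ` ?X" by (force intro!: image_eqI[of _ _ "(j, L, R)"])
  qed
qed

section \<open>The recurrence for the generating function\<close>

lemma finite_S_av: "finite (S_av n \<tau>)"
  by (simp add: S_av_def S_def)

lemma Q_0: "Q 0 x1 x2 x3 x4 x5 x6 x7 = 1"
proof -
  have "S_av 0 [1,3,2] = {[]}"
    by (auto simp: S_av_def avoids_def S_def occr_eqs[unfolded One_nat_def])
  then show ?thesis
    by (simp add: Q_def occr_eqs[unfolded One_nat_def])
qed

text \<open>The recurrence is indexed from zero: j stands for k - 1, so \<open>Suc j\<close> is k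
  and \<open>m - j\<close> is n - k.\<close>

lemma Q_Suc:
  fixes x1 x2 x3 x4 x5 x6 x7 :: "'a::comm_semiring_1"
  shows "Q (Suc m) x1 x2 x3 x4 x5 x6 x7 =
    (\<Sum>j\<le>m. x1 ^ j * x2 ^ (Suc j * (m - j)) * x5 ^ (j * (m - j)) *
       Q j (x1 * x3 * x5 ^ (m - j)) (x2 * x4 * x7 ^ (m - j)) x3 x4 x5 x6 x7 *
       Q (m - j) (x1 * x6 ^ Suc j) (x2 * x7 ^ Suc j) x3 x4 x5 x6 x7)"
proof -
  \<comment> \<open>Only the first two arguments vary, since the recurrence leaves \<open>x3\<close>
    to \<open>x7\<close> unchanged.\<close>
  define W where "W y1 y2 \<sigma> =
    y1 ^ occr [1,2] \<sigma> * y2 ^ occr [2,1] \<sigma> * x3 ^ occr [1,2,3] \<sigma> * x4 ^ occr [2,1,3] \<sigma> *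
    x5 ^ occr [2,3,1] \<sigma> * x6 ^ occr [3,1,2] \<sigma> * x7 ^ occr [3,2,1] \<sigma>" for y1 y2 :: 'a and \<sigma>
  have Q: "Q n y1 y2 x3 x4 x5 x6 x7 = sum (W y1 y2) (S_av n [1,3,2])" for n y1 y2
    by (simp add: Q_def W_def)
  \<comment> \<open>Exponents are collected by statistic. The 12-count of \<open>L\<close> enters
    those of 12 and 123 once and that of 231 i times, giving \<open>x1 * x3 * x5 ^ i\<close>; its
    21-count enters those of 21, 213 and 321 likewise. The 12- and 21-counts of \<open>R\<close>
    enter those of 312 and 321 with factor \<open>Suc j\<close>. The terms in lengths alone form the
    prefactor.\<close>
  have W: "W x1 x2 (join L R) =
      x1 ^ j * x2 ^ (Suc j * i) * x5 ^ (j * i) *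
      W (x1 * x3 * x5 ^ i) (x2 * x4 * x7 ^ i) L * W (x1 * x6 ^ Suc j) (x2 * x7 ^ Suc j) R"
    if "L \<in> S j" "R \<in> S i" for L R j i
    unfolding W_def occr_join[OF S_set_length[OF that(1)] S_set_length[OF that(2)]]
      S_length[OF that(1)] S_length[OF that(2)]
    by (simp add: power_add power_mult_distrib ac_simps del: power_Suc mult_Suc flip: power_mult)
  have "Q (Suc m) x1 x2 x3 x4 x5 x6 x7 =
      (\<Sum>(j, L, R)\<in>(SIGMA j:{..m}. S_av j [1,3,2] \<times> S_av (m - j) [1,3,2]). W x1 x2 (join L R))"
    unfolding Q sum.reindex_bij_betw[OF bij_betw_join, symmetric] by (simp add: case_prod_unfold)
  also have "\<dots> = (\<Sum>j\<le>m. \<Sum>(L, R)\<in>S_av j [1,3,2] \<times> S_av (m - j) [1,3,2]. W x1 x2 (join L R))"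
    by (subst sum.Sigma) (auto simp: finite_S_av)
  also have "\<dots> = (\<Sum>j\<le>m. x1 ^ j * x2 ^ (Suc j * (m - j)) * x5 ^ (j * (m - j)) *
       sum (W (x1 * x3 * x5 ^ (m - j)) (x2 * x4 * x7 ^ (m - j))) (S_av j [1,3,2]) *
       sum (W (x1 * x6 ^ Suc j) (x2 * x7 ^ Suc j)) (S_av (m - j) [1,3,2]))" (is "_ = sum ?g _")
  proof (rule sum.cong[OF refl])
    fix j assume "j \<in> {..m}"
    let ?c = "x1 ^ j * x2 ^ (Suc j * (m - j)) * x5 ^ (j * (m - j))"
    let ?V = "W (x1 * x3 * x5 ^ (m - j)) (x2 * x4 * x7 ^ (m - j))"
    let ?U = "W (x1 * x6 ^ Suc j) (x2 * x7 ^ Suc j)"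
    have "(\<Sum>(L, R)\<in>S_av j [1,3,2] \<times> S_av (m - j) [1,3,2]. W x1 x2 (join L R)) =
        (\<Sum>L\<in>S_av j [1,3,2]. \<Sum>R\<in>S_av (m - j) [1,3,2]. ?c * ?V L * ?U R)"
      unfolding sum.cartesian_product[symmetric]
      by (intro sum.cong refl W) (auto simp: S_av_def)
    \<comment> \<open>\<open>L\<close> and \<open>R\<close> vary independently, so the double sum is
      a product.\<close>
    also have "\<dots> = ?g j"
      by (simp only: sum_distrib_left[symmetric] sum_distrib_right[symmetric])
    finally show "(\<Sum>(L, R)\<in>S_av j [1,3,2] \<times> S_av (m - j) [1,3,2]. W x1 x2 (join L R)) = ?g j" .
  qed
  finally show ?thesis unfolding Q .
qed

theorem theorem2:
  fixes x1 x2 x3 x4 x5 x6 x7 :: "'a::comm_semiring_1"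
  shows "Q 0 x1 x2 x3 x4 x5 x6 x7 = 1 \<and>
    (\<forall>n\<ge>1. Q n x1 x2 x3 x4 x5 x6 x7 =
      (\<Sum>k=1..n. x1 ^ (k - 1) * x2 ^ (k * (n - k)) * x5 ^ ((k - 1) * (n - k)) *
         Q (k - 1) (x1 * x3 * x5 ^ (n - k)) (x2 * x4 * x7 ^ (n - k)) x3 x4 x5 x6 x7 *
         Q (n - k) (x1 * x6 ^ k) (x2 * x7 ^ k) x3 x4 x5 x6 x7))"
proof (intro conjI allI impI)
  show "Q 0 x1 x2 x3 x4 x5 x6 x7 = 1" by (rule Q_0)
next
  fix n :: nat assume "n \<ge> 1"
  then obtain m where n: "n = Suc m" by (cases n) auto
  show "Q n x1 x2 x3 x4 x5 x6 x7 =
      (\<Sum>k=1..n. x1 ^ (k - 1) * x2 ^ (k * (n - k)) * x5 ^ ((k - 1) * (n - k)) *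
         Q (k - 1) (x1 * x3 * x5 ^ (n - k)) (x2 * x4 * x7 ^ (n - k)) x3 x4 x5 x6 x7 *
         Q (n - k) (x1 * x6 ^ k) (x2 * x7 ^ k) x3 x4 x5 x6 x7)"
    \<comment> \<open>Substituting k = \<open>Suc j\<close> moves the range from 1..n to
      0..m.\<close>
    unfolding n Q_Suc One_nat_def sum.shift_bounds_cl_Suc_ivl by (simp add: atMost_atLeast0)
qed

end
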